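(* Let $q=2^r$. Then the following hold. (a) If $r\ge 3$, then for every $h=1,2,\ldots$, \[ MK^h=\sum_{l=0}^{h-1}(-1)^{h+l+1}\binom{h}{l}(q-1)^{h-l}MK^l+q\sum_{j=0}^{\min\{q-2,\,h\}}(-1)^{h+j}C_{1,j}\sum_{t=j}^{h}t!\,S(h,t)\,2^{h-t}\binom{q-2-j}{q-2-t}, \] where $\{C_{1,j}\}_{j=0}^{q-2}$ is the weight distribution of the binary linear code $C_1$, and it is given by \[ C_{1,j}=\sum\prod_{tr(\beta^{-1})=0}\binom{2}{\nu_\beta}\quad(j=0,\ldots,q-2), \] the sum being over all sets of nonnegative integers $\{\nu_\beta\}_{\beta\in\mathbb{F}_q^*,\,tr(\beta^{-1})=0}$ with $\sum_{tr(\beta^{-1})=0}\nu_\beta=j$ and $\sum_{tr(\beta^{-1})=0}\nu_\beta\beta=0$ (in $\mathbb{F}_q$). (b) If $r\ge 3$, then for every $h=1,2,\ldots$, \[ MK^h=\sum_{l=0}^{h-1}(-1)^{h+l+1}\binom{h}{l}(q-1)^{h-l}MK^l+q\sum_{j=0}^{\min\{\frac q2-1,\,h\}}(-1)^{h+j}C_{2,j}\sum_{t=j}^{h}t!\,S(h,t)\,2^{2h-t}\binom{\frac q2-1-j}{\frac q2-1-t}, \] where $\{C_{2,j}\}_{j=0}^{q/2-1}$ is the weight distribution of the binary linear code $C_2$, and $C_{2,j}$ ($0\le j\le \frac q2-1$) equals the number of sets of integers $\{\nu_\beta\}_{\beta\in\mathbb{F}_q^*,\,tr(\beta^{-1})=0}$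 with each $\nu_\beta\in\{0,1\}$, $\sum_{tr(\beta^{-1})=0}\nu_\beta=j$ and $\sum_{tr(\beta^{-1})=0}\nu_\beta\beta=0$. (c) For every $h=1,2,\ldots$, \[ MK^h=-\sum_{l=0}^{h-1}\binom{h}{l}(q+1)^{h-l}MK^l+q\sum_{j=0}^{\min\{q,\,h\}}(-1)^{j}C_{3,j}\sum_{t=j}^{h}t!\,S(h,t)\,2^{h-t}\binom{q-j}{q-t}, \] where $\{C_{3,j}\}_{j=0}^{q}$ is the weight distribution of the binary linear code $C_3$, and it is given by \[ C_{3,j}=\sum\prod_{tr(\beta^{-1})=1}\binom{2}{\nu_\beta}\quad(j=0,\ldots,q), \] the sum being over all sets of nonnegative integers $\{\nu_\beta\}_{tr(\beta^{-1})=1}$ with $\sum_{tr(\beta^{-1})=1}\nu_\beta=j$ and $\sum_{tr(\beta^{-1})=1}\nu_\beta\beta=0$. (d) For every $h=1,2,\ldots$, \[ MK^h=-\sum_{l=0}^{h-1}\binom{h}{l}(q+1)^{h-l}MK^l+q\sum_{j=0}^{\min\{\frac q2,\,h\}}(-1)^{j}C_{4,j}\sum_{t=j}^{h}t!\,S(h,t)\,2^{2h-t}\binom{\frac q2-j}{\frac q2-t}, \] where $\{C_{4,j}\}_{j=0}^{q/2}$ is the weight distribution of the binary linear code $C_4$, and $C_{4,j}$ ($0\le j\le\frac q2$) equals the number of sets of integers $\{\nu_\beta\}_{tr(\beta^{-1})=1}$ with each $\nu_\beta\in\{0,1\}$, $\sum_{tr(\beta^{-1})=1}\nu_\beta=j$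 and $\sum_{tr(\beta^{-1})=1}\nu_\beta\beta=0$.
   Context: $q=2^r$ with $r\ge1$ an integer, $\mathbb{F}_q$ the field with $q$ elements, $tr(x)=x+x^2+\cdots+x^{2^{r-1}}$ the trace $\mathbb{F}_q\to\mathbb{F}_2$, and $\lambda(x)=(-1)^{tr(x)}$ the canonical additive character. For $a\in\mathbb{F}_q^*$ the Kloosterman sum is $K(\lambda;a)=\sum_{\alpha\in\mathbb{F}_q^*}\lambda(\alpha+a\alpha^{-1})$, and for each integer $h\ge0$, $MK^h=\sum_{a\in\mathbb{F}_q^*}K(\lambda;a)^h$ (so $MK^0=q-1$). $S(h,t)=\frac1{t!}\sum_{j=0}^t(-1)^{t-j}\binom{t}{j}j^h$ is the Stirling number of the second kind. Convention: $\binom{b}{a}=0$ if $a>b$ or $a<0$. In the conditions $tr(\beta^{-1})=0$ the element $\beta$ ranges over $\mathbb{F}_q^*$ (and $tr(\beta^{-1})=1$ forces $\beta\ne0$). Codes: Fix $b\in\mathbb{F}_q$ with $tr(b)=1$, and fix an ordering $\gamma_0=0,\gamma_1,\ldots,\gamma_{q/2-1}$ of the set $\{\beta\in\mathbb{F}_q: tr\beta=0\}=\{\alpha^2+\alpha:\alpha\in\mathbb{F}_q\}$. Put $N_1=q-2$, $N_2=\frac q2-1$, $N_3=q$, $N_4=\frac q2$ and $v_1=(\gamma_1^{-1},\ldots,\gamma_{q/2-1}^{-1},\gamma_1^{-1},\ldots,\gamma_{q/2-1}^{-1})\in\mathbb{F}_q^{N_1}$, $v_2=(\gamma_1^{-1},\ldots,\gamma_{q/2-1}^{-1})\in\mathbb{F}_q^{N_2}$,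 $v_3=((b+\gamma_0)^{-1},\ldots,(b+\gamma_{q/2-1})^{-1},(b+\gamma_0)^{-1},\ldots,(b+\gamma_{q/2-1})^{-1})\in\mathbb{F}_q^{N_3}$, $v_4=((b+\gamma_0)^{-1},\ldots,(b+\gamma_{q/2-1})^{-1})\in\mathbb{F}_q^{N_4}$. For $i=1,2,3,4$, $C_i=\{u\in\mathbb{F}_2^{N_i}: u\cdot v_i=0\}$, where $u\cdot v_i=\sum_k u_k (v_i)_k$ computed in $\mathbb{F}_q$. Its weight distribution is $C_{i,j}$ = number of codewords of Hamming weight $j$. *)

theory Defs
  imports Complex_Main "HOL-Combinatorics.Stirling" "HOL-Library.Z2"
    "HOL-Library.FuncSet" "HOL-Library.Cardinality"
begin

text \<open>The absolute trace from the field with \<open>2 ^ r\<close> elements to its prime field,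
  with values in \<open>{0, 1}\<close> inside the big field.\<close>

definition tr :: "nat \<Rightarrow> 'a::field \<Rightarrow> 'a" where
  "tr r x = (\<Sum>i<r. x ^ (2 ^ i))"

definition canonical_char :: "nat \<Rightarrow> 'a::field \<Rightarrow> complex" where
  "canonical_char r x = (if tr r x = 0 then 1 else -1)"

definition kloosterman :: "('a::field \<Rightarrow> complex) \<Rightarrow> 'a \<Rightarrow> complex" where
  "kloosterman \<psi> a = (\<Sum>\<alpha>\<in>UNIV - {0}. \<psi> (\<alpha> + a * inverse \<alpha>))"

definition MK :: "('a::field \<Rightarrow> complex) \<Rightarrow> nat \<Rightarrow> complex" where
  "MK \<psi> h = (\<Sum>a\<in>UNIV - {0}. kloosterman \<psi> a ^ h)"

text \<open>Binomial coefficients with the convention that they vanish when the lower index is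
  negative or exceeds the upper one. Integer arguments are needed because lower indices such as
  \<open>n - t\<close> with \<open>t > n\<close> occur, where truncated subtraction on
  \<open>nat\<close> would yield \<open>1\<close> instead of \<open>0\<close>.\<close>

definition binom :: "int \<Rightarrow> int \<Rightarrow> nat" where
  "binom m k = (if 0 \<le> k \<and> k \<le> m then nat m choose nat k else 0)"

text \<open>The library's \<^const>\<open>Stirling\<close> numbers of the second kind, defined by recursion,
  satisfy the usual explicit formula.\<close>

lemma fact_mult_Stirling:
  "(fact t * of_nat (Stirling h t) :: 'a::field_char_0) =
     (\<Sum>j\<le>t. (-1) ^ (t - j) * of_nat (t choose j) * of_nat j ^ h)"
proof (induction h arbitrary: t)
  case 0
  have "(\<Sum>j\<le>t. (-1) ^ (t - j) * of_nat (t choose j) :: 'a) = (1 + (-1)) ^ t"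
    by (subst binomial_ring) (simp add: mult.commute)
  then show ?case
    by (cases t) auto
next
  case (Suc h)
  show ?case
  proof (cases t)
    case 0
    then show ?thesis by simp
  next
    case (Suc s)
    have absorb: "(of_nat t :: 'a) * of_nat (s choose j) = of_nat (t - j) * of_nat (t choose j)"
      if "j \<le> s" for j
    proof -
      have "t * (s choose j) = (t - j) * (t choose j)"
        using binomial_absorb_comp[of t j] Suc by simp
      then show ?thesis
        by (metis of_nat_mult)
    qed
    have sgn: "(-1 :: 'a) ^ (s - j) = - ((-1) ^ (t - j))" if "j \<le> s" for j
      using that Suc by (simp add: Suc_diff_le)
    have "(of_nat t :: 'a) * (fact s * of_nat (Stirling h s)) =
        (\<Sum>j\<le>s. (-1) ^ (s - j) * (of_nat t * of_nat (s choose j)) * of_nat j ^ h)"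
      unfolding Suc.IH by (simp add: sum_distrib_left mult_ac)
    also have "\<dots> = (\<Sum>j\<le>s. - ((-1) ^ (t - j)) * (of_nat (t - j) * of_nat (t choose j)) * of_nat j ^ h)"
      by (intro sum.cong refl) (simp only: absorb sgn atMost_iff)
    also have "\<dots> = (\<Sum>j\<le>t. - ((-1) ^ (t - j)) * (of_nat (t - j) * of_nat (t choose j)) * of_nat j ^ h)"
      by (simp add: Suc)
    finally have A: "(of_nat t :: 'a) * (fact s * of_nat (Stirling h s)) = \<dots>" .
    have "(fact t * of_nat (Stirling (Suc h) t) :: 'a) =
        of_nat t * (fact t * of_nat (Stirling h t)) + of_nat t * (fact s * of_nat (Stirling h s))"
      by (simp add: Suc algebra_simps)
    also have "\<dots> = (\<Sum>j\<le>t. (-1) ^ (t - j) * of_nat (t choose j) * of_nat j ^ Suc h)"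
      unfolding A unfolding Suc.IH sum_distrib_left sum.distrib[symmetric]
      by (intro sum.cong refl) (simp add: of_nat_diff algebra_simps)
    finally show ?thesis .
  qed
qed

lemma Stirling_explicit:
  "(of_nat (Stirling h t) :: 'a::field_char_0) =
     1 / fact t * (\<Sum>j=0..t. (-1) ^ (t - j) * of_nat (t choose j) * of_nat j ^ h)"
  by (simp add: fact_mult_Stirling[symmetric] atLeast0AtMost)

text \<open>The binary code of length \<open>length v\<close> orthogonal to a vector \<open>v\<close> over an extension field
  of the field with two elements; the inner product is computed in the extension.\<close>

definition code :: "'a::field list \<Rightarrow> bit list set" where
  "code v = {u. length u = length v \<and> (\<Sum>k<length v. of_bit (u ! k) * v ! k) = 0}"

definition hamming_weight :: "bit list \<Rightarrow> nat" where
  "hamming_weight u = card {k. k < length u \<and> u ! k \<noteq> 0}"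

definition weight_distribution :: "bit list set \<Rightarrow> nat \<Rightarrow> nat" where
  "weight_distribution C j = card {u \<in> C. hamming_weight u = j}"

text \<open>In the following, \<open>q = 2 ^ r\<close>, and \<open>\<gamma> 0 = 0, \<gamma> 1, \<dots>, \<gamma> (q div 2 - 1)\<close> enumerates
  the elements of trace \<open>0\<close>.\<close>

definition vec1 :: "nat \<Rightarrow> (nat \<Rightarrow> 'a::field) \<Rightarrow> 'a list" where
  "vec1 q \<gamma> = map (\<lambda>k. inverse (\<gamma> k)) [1..<q div 2] @ map (\<lambda>k. inverse (\<gamma> k)) [1..<q div 2]"

definition vec2 :: "nat \<Rightarrow> (nat \<Rightarrow> 'a::field) \<Rightarrow> 'a list" where
  "vec2 q \<gamma> = map (\<lambda>k. inverse (\<gamma> k)) [1..<q div 2]"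

definition vec3 :: "nat \<Rightarrow> 'a::field \<Rightarrow> (nat \<Rightarrow> 'a) \<Rightarrow> 'a list" where
  "vec3 q b \<gamma> =
     map (\<lambda>k. inverse (b + \<gamma> k)) [0..<q div 2] @ map (\<lambda>k. inverse (b + \<gamma> k)) [0..<q div 2]"

definition vec4 :: "nat \<Rightarrow> 'a::field \<Rightarrow> (nat \<Rightarrow> 'a) \<Rightarrow> 'a list" where
  "vec4 q b \<gamma> = map (\<lambda>k. inverse (b + \<gamma> k)) [0..<q div 2]"

definition inv_trace_set :: "nat \<Rightarrow> 'a::field \<Rightarrow> 'a set" where
  "inv_trace_set r c = {\<beta>. \<beta> \<noteq> 0 \<and> tr r (inverse \<beta>) = c}"

text \<open>Families \<open>(\<nu> \<beta>)\<close> indexed by \<open>\<beta> \<in> S\<close> with entries in \<open>M\<close>, total \<open>j\<close>, and weighted sum \<open>0\<close>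
  in the field. Using extensional functions, two families are equal iff they agree on \<open>S\<close>.\<close>

definition families :: "'a::field set \<Rightarrow> nat set \<Rightarrow> nat \<Rightarrow> ('a \<Rightarrow> nat) set" where
  "families S M j =
     {\<nu> \<in> S \<rightarrow>\<^sub>E M. (\<Sum>\<beta>\<in>S. \<nu> \<beta>) = j \<and> (\<Sum>\<beta>\<in>S. of_nat (\<nu> \<beta>) * \<beta>) = 0}"

end

theory Submission
  imports Defs
begin

text \<open>
  For a list \<open>v\<close> of length \<open>N\<close> let \<open>w a\<close> be the number of positions \<open>k\<close> with \<open>tr (a * v ! k) \<noteq> 0\<close>.
  Expanding \<open>w a choose t\<close> as the sum of \<open>\<Prod>k\<in>T. (1 - \<psi> (a * v ! k)) / 2\<close> over the \<open>t\<close>-subsets \<open>T\<close>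
  of positions and summing over \<open>a\<close>, orthogonality of characters leaves exactly the supports of
  words of \<open>code v\<close>. With \<open>w ^ h = (\<Sum>t\<le>h. fact t * Stirling h t * (w choose t))\<close> this gives the
  Pless power moment identity for the words \<open>(tr (a * v ! k))\<^sub>k\<close>; as \<open>a\<close> itself is the summation
  variable, neither Delsarte's theorem nor injectivity of \<open>a \<mapsto> (tr (a * v ! k))\<^sub>k\<close> enters. When \<open>v\<close> enumerates the \<open>\<beta>\<close> with prescribed trace of
  \<open>inverse \<beta>\<close>, the weight \<open>w a\<close> is an affine function of \<open>K(a)\<close> for \<open>a \<noteq> 0\<close>, and the binomial
  theorem turns the moments of \<open>w\<close> into the recursion. The weight distributions are found by
  counting supports with given intersection numbers with the fibres of \<open>k \<mapsto> v ! k\<close>.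
\<close>

subsection \<open>Finite fields and counting\<close>

text \<open>Multiplication by a nonzero \<open>x\<close> permutes the nonzero elements; comparing
  their product before and after makes \<open>x\<close> to the power \<open>q - 1\<close> equal to
  1.\<close>

lemma power_card_eq_self:
  fixes x :: "'a::{finite, field}"
  shows "x ^ CARD('a) = x"
proof (cases "x = 0")
  case False
  let ?A = "UNIV - {0::'a}"
  have "inj_on ((*) x) ?A" "(*) x ` ?A = ?A"
    using False by (auto simp: inj_on_def intro!: image_eqI[of _ _ "_ / x"])
  then have "(\<Prod>y\<in>?A. y) = (\<Prod>y\<in>?A. x * y)"
    using prod.reindex[of "(*) x" ?A "\<lambda>y. y"] by simp
  then have "(\<Prod>y\<in>?A. y) = x ^ card ?A * (\<Prod>y\<in>?A. y)"
    by (simp add: prod.distrib)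
  then have "x ^ card ?A = 1"
    by simp
  moreover have "CARD('a) = Suc (card ?A)"
    by (metis UNIV_I card_Suc_Diff1 finite)
  ultimately show ?thesis
    by (metis mult.right_neutral power_Suc)
qed simp

text \<open>Translation by 1 permutes the field, so adding 1 to every summand leaves the total
  unchanged. This is the source of characteristic 2 below.\<close>

lemma of_nat_card_eq_0: "of_nat CARD('a) = (0 :: 'a::{finite, field})"
proof -
  have "(\<Sum>x\<in>UNIV. x + 1) = (\<Sum>x\<in>UNIV. x :: 'a)"
    by (rule sum.reindex_bij_witness[of _ "\<lambda>x. x - 1" "\<lambda>x. x + 1"]) auto
  then show ?thesis
    by (simp add: sum.distrib)
qed

lemma power_eq_sum_Stirling:
  "(n::nat) ^ h = (\<Sum>t\<le>h. fact t * Stirling h t * (n choose t))"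
proof (induction h)
  case (Suc h)
  let ?f = "\<lambda>t. fact t * Stirling h t * (t * (n choose t))"
  let ?g = "\<lambda>t. fact (Suc t) * Stirling h t * (n choose Suc t)"
  have absorb: "n * (n choose t) = t * (n choose t) + Suc t * (n choose Suc t)" for t
  proof (cases "t \<le> n")
    case True
    have "Suc t * (n choose Suc t) = (n - t) * (n choose t)"
      by (metis binomial_absorption binomial_absorb_comp mult.commute)
    then show ?thesis
      using True by (metis add_mult_distrib le_add_diff_inverse)
  qed (simp add: binomial_eq_0)
  have "n ^ Suc h = (\<Sum>t\<le>h. fact t * Stirling h t * (n * (n choose t)))"
    using Suc.IH by (simp add: sum_distrib_left mult_ac)
  also have "\<dots> = (\<Sum>t\<le>h. ?f t) + (\<Sum>t\<le>h. ?g t)"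
    unfolding absorb sum.distrib[symmetric] by (intro sum.cong) (auto simp: algebra_simps)
  \<comment> \<open>The added term vanishes because \<open>Stirling h (Suc h) = 0\<close>, and the
    term at \<open>t = 0\<close> vanishes by its factor \<open>t\<close>. After the shift the two
    sums combine by the Stirling recursion.\<close>
  also have "(\<Sum>t\<le>h. ?f t) = (\<Sum>t\<le>Suc h. ?f t)"
    by simp
  also have "\<dots> = (\<Sum>t\<le>h. ?f (Suc t))"
    by (subst sum.atMost_Suc_shift) simp
  also have "(\<Sum>t\<le>h. ?f (Suc t)) + (\<Sum>t\<le>h. ?g t)
    = (\<Sum>t\<le>h. fact (Suc t) * Stirling (Suc h) (Suc t) * (n choose Suc t))"
    unfolding sum.distrib[symmetric] by (intro sum.cong) (auto simp: algebra_simps)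
  also have "\<dots> = (\<Sum>t\<le>Suc h. fact t * Stirling (Suc h) t * (n choose t))"
    by (subst sum.atMost_Suc_shift) simp
  finally show ?case .
qed simp

text \<open>Complementation in \<open>I\<close> turns \<open>T\<close> into a subset of
  \<open>I - U\<close> with \<open>card I - t\<close> elements, which gives the lower index its
  form. Integer arguments make the count 0 for \<open>t > card I\<close>.\<close>

lemma card_between_subsets:
  assumes "finite I" "U \<subseteq> I"
  shows "card {T. U \<subseteq> T \<and> T \<subseteq> I \<and> card T = t}
    = binom (int (card I) - int (card U)) (int (card I) - int t)"
proof (cases "t \<le> card I")
  case True
  have fin: "finite U" using assms finite_subset by blast
  have compl: "card (I - V) = card I - card V" if "V \<subseteq> I" for V
    using that assms(1) by (simp add: card_Diff_subset finite_subset)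
  have "bij_betw (\<lambda>T. I - T) {T. U \<subseteq> T \<and> T \<subseteq> I \<and> card T = t}
      {V. V \<subseteq> I - U \<and> card V = card I - t}"
    by (rule bij_betw_byWitness[where f' = "\<lambda>V. I - V"])
      (use True assms in \<open>auto simp: compl subset_Diff_insert dest: subset_trans[OF _ Diff_subset]\<close>)
  then have "card {T. U \<subseteq> T \<and> T \<subseteq> I \<and> card T = t} = (card I - card U) choose (card I - t)"
    using assms fin by (simp add: bij_betw_same_card n_subsets card_Diff_subset)
  moreover have "card U \<le> card I"
    using assms by (simp add: card_mono)
  ultimately show ?thesis
    using True by (auto simp: binom_def nat_diff_distrib)
next
  case False
  then have "{T. U \<subseteq> T \<and> T \<subseteq> I \<and> card T = t} = {}"
    using assms(1) card_mono by blast
  then have "card {T. U \<subseteq> T \<and> T \<subseteq> I \<and> card T = t} = 0"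
    by (simp only: card.empty)
  then show ?thesis
    using False by (simp add: binom_def)
qed

subsection \<open>Weight distributions\<close>

text \<open>A binary word is determined by its support, and its inner product with \<open>v\<close>
  is the sum of \<open>v\<close> over that support.\<close>

lemma code_bij_betw_zero_sum_subsets:
  "bij_betw (\<lambda>u. {k. k < length u \<and> u ! k \<noteq> 0}) {u \<in> code v. hamming_weight u = j}
    {U. U \<subseteq> {..<length v} \<and> card U = j \<and> (\<Sum>k\<in>U. v ! k) = 0}"
proof (rule bij_betw_byWitness[where f' = "\<lambda>U. map (\<lambda>k. of_bool (k \<in> U)) [0..<length v]"])
  have [simp]: "{..<n} \<inter> {k. P k} = {k. k < n \<and> P k}" for n :: nat and P
    by auto
  show "\<forall>u\<in>{u \<in> code v. hamming_weight u = j}.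
      map (\<lambda>k. of_bool (k \<in> {k. k < length u \<and> u ! k \<noteq> 0})) [0..<length v] = u"
    by (auto simp: code_def intro!: nth_equalityI)
  show "\<forall>U\<in>{U. U \<subseteq> {..<length v} \<and> card U = j \<and> (\<Sum>k\<in>U. v ! k) = 0}.
      {k. k < length (map (\<lambda>k. of_bool (k \<in> U)) [0..<length v]) \<and>
        map (\<lambda>k. of_bool (k \<in> U)) [0..<length v] ! k \<noteq> (0::bit)} = U"
    by auto
  show "(\<lambda>u. {k. k < length u \<and> u ! k \<noteq> 0}) ` {u \<in> code v. hamming_weight u = j}
      \<subseteq> {U. U \<subseteq> {..<length v} \<and> card U = j \<and> (\<Sum>k\<in>U. v ! k) = 0}"
    by (auto simp: code_def hamming_weight_def)
  show "(\<lambda>U. map (\<lambda>k. of_bool (k \<in> U)) [0..<length v]) `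
      {U. U \<subseteq> {..<length v} \<and> card U = j \<and> (\<Sum>k\<in>U. v ! k) = 0}
      \<subseteq> {u \<in> code v. hamming_weight u = j}"
  proof clarify
    fix U assume U: "U \<subseteq> {..<length v}" "(\<Sum>k\<in>U. v ! k) = 0"
    let ?u = "map (\<lambda>k. of_bool (k \<in> U)) [0..<length v] :: bit list"
    have supp: "{k. k < length v \<and> ?u ! k = 1} = U"
      using U(1) by auto
    have "hamming_weight ?u = card U"
      by (simp add: hamming_weight_def supp)
    moreover have "?u \<in> code v"
      using U by (simp add: code_def supp)
    ultimately show "?u \<in> code v \<and> hamming_weight ?u = card U"
      by simp
  qed
qed

lemma weight_distribution_code:
  "weight_distribution (code v) j
    = card {U. U \<subseteq> {..<length v} \<and> card U = j \<and> (\<Sum>k\<in>U. v ! k) = 0}"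
  unfolding weight_distribution_def
  using code_bij_betw_zero_sum_subsets by (rule bij_betw_same_card)

text \<open>A subset of \<open>I\<close> amounts to an independent choice of its part in each fibre
  of \<open>g\<close>; prescribing the sizes of the parts yields one binomial factor per
  fibre.\<close>

lemma card_subsets_with_fibre_cards:
  assumes "finite I" "finite S" "g ` I \<subseteq> S" "\<nu> \<in> extensional S"
  shows "card {U. U \<subseteq> I \<and> restrict (\<lambda>\<beta>. card {k\<in>U. g k = \<beta>}) S = \<nu>}
    = (\<Prod>\<beta>\<in>S. card {k\<in>I. g k = \<beta>} choose \<nu> \<beta>)"
proof -
  let ?P = "\<Pi>\<^sub>E \<beta>\<in>S. {A. A \<subseteq> {k\<in>I. g k = \<beta>} \<and> card A = \<nu> \<beta>}"
  have "bij_betw (\<lambda>U. restrict (\<lambda>\<beta>. {k\<in>U. g k = \<beta>}) S)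
      {U. U \<subseteq> I \<and> restrict (\<lambda>\<beta>. card {k\<in>U. g k = \<beta>}) S = \<nu>} ?P"
  proof (rule bij_betw_byWitness[where f' = "\<lambda>F. \<Union>\<beta>\<in>S. F \<beta>"])
    \<comment> \<open>Distinct fibres are disjoint, so intersecting the union with the fibre over
      \<beta> recovers exactly \<open>F \<beta>\<close>.\<close>
    have fib: "{k. (\<exists>\<beta>'\<in>S. k \<in> F \<beta>') \<and> g k = \<beta>} = F \<beta>" if "F \<in> ?P" "\<beta> \<in> S" for F \<beta>
      using that by (fastforce simp: PiE_iff)
    show "\<forall>F\<in>?P. restrict (\<lambda>\<beta>. {k \<in> \<Union>\<beta>\<in>S. F \<beta>. g k = \<beta>}) S = F"
    proof
      fix F assume F: "F \<in> ?P"
      then show "restrict (\<lambda>\<beta>. {k \<in> \<Union>\<beta>\<in>S. F \<beta>. g k = \<beta>}) S = F"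
        by (intro extensionalityI[of _ S]) (auto simp: fib[OF F] PiE_iff)
    qed
    show "(\<lambda>F. \<Union>\<beta>\<in>S. F \<beta>) ` ?P \<subseteq>
        {U. U \<subseteq> I \<and> restrict (\<lambda>\<beta>. card {k\<in>U. g k = \<beta>}) S = \<nu>}"
    proof clarify
      fix F assume F: "F \<in> ?P"
      have "restrict (\<lambda>\<beta>. card {k \<in> \<Union>\<beta>\<in>S. F \<beta>. g k = \<beta>}) S = \<nu>"
        using F assms(4) by (intro extensionalityI[of _ S]) (auto simp: fib[OF F] PiE_iff)
      then show "(\<Union>\<beta>\<in>S. F \<beta>) \<subseteq> I \<and> restrict (\<lambda>\<beta>. card {k \<in> \<Union>\<beta>\<in>S. F \<beta>. g k = \<beta>}) S = \<nu>"
        using F by (fastforce simp: PiE_iff)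
    qed
  qed (use assms(3) in auto)
  then have "card {U. U \<subseteq> I \<and> restrict (\<lambda>\<beta>. card {k\<in>U. g k = \<beta>}) S = \<nu>} = card ?P"
    by (rule bij_betw_same_card)
  also have "\<dots> = (\<Prod>\<beta>\<in>S. card {k\<in>I. g k = \<beta>} choose \<nu> \<beta>)"
    using assms by (simp add: card_PiE n_subsets)
  finally show ?thesis .
qed

text \<open>Even for infinite \<open>M\<close>, the prescribed total \<open>j\<close> bounds every
  entry.\<close>

lemma finite_families: "finite S \<Longrightarrow> finite (families S M j)"
proof (rule finite_subset)
  assume "finite S"
  then show "families S M j \<subseteq> S \<rightarrow>\<^sub>E {..j}"
    by (auto simp: families_def PiE_iff extensional_def intro: member_le_sum)
  show "finite (S \<rightarrow>\<^sub>E {..j})"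
    using \<open>finite S\<close> by (intro finite_PiE) auto
qed

text \<open>Zero-sum supports are classified by \<open>?n U\<close>, which records how many
  positions of each value they use. Each fibre has \<open>m\<close> positions, whence the factors
  \<open>m choose \<nu> \<beta>\<close>.\<close>

lemma weight_distribution_code_constant_multiplicity:
  assumes mult: "\<And>\<beta>. \<beta> \<in> set v \<Longrightarrow> count_list v \<beta> = m"
  shows "weight_distribution (code v) j = (\<Sum>\<nu>\<in>families (set v) UNIV j. \<Prod>\<beta>\<in>set v. m choose \<nu> \<beta>)"
proof -
  let ?S = "set v" and ?I = "{..<length v}"
  let ?Z = "{U. U \<subseteq> ?I \<and> card U = j \<and> (\<Sum>k\<in>U. v ! k) = 0}"
  let ?n = "\<lambda>U. restrict (\<lambda>\<beta>. card {k\<in>U. v ! k = \<beta>}) ?S"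
  have sums: "(\<Sum>\<beta>\<in>?S. ?n U \<beta>) = card U" "(\<Sum>\<beta>\<in>?S. of_nat (?n U \<beta>) * \<beta>) = (\<Sum>k\<in>U. v ! k)"
    if "U \<subseteq> ?I" for U
  proof -
    have fin: "finite U" and im: "(!) v ` U \<subseteq> ?S"
      using that finite_subset by auto
    show "(\<Sum>\<beta>\<in>?S. ?n U \<beta>) = card U"
      using sum.group[OF fin finite_set im, of "\<lambda>_. 1::nat"] by simp
    show "(\<Sum>\<beta>\<in>?S. of_nat (?n U \<beta>) * \<beta>) = (\<Sum>k\<in>U. v ! k)"
      using sum.group[OF fin finite_set im, of "(!) v"] by simp
  qed
  have finZ: "finite ?Z"
    by (rule finite_subset[of _ "Pow ?I"]) auto
  have im: "?n ` ?Z \<subseteq> families ?S UNIV j"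
    using sums by (auto simp: families_def)
  have "card ?Z = (\<Sum>\<nu>\<in>families ?S UNIV j. card {U\<in>?Z. ?n U = \<nu>})"
    using sum.group[OF finZ finite_families[OF finite_set] im, of "\<lambda>_. 1::nat"] by simp
  also have "\<dots> = (\<Sum>\<nu>\<in>families ?S UNIV j. \<Prod>\<beta>\<in>?S. m choose \<nu> \<beta>)"
  proof (intro sum.cong refl)
    fix \<nu> assume \<nu>: "\<nu> \<in> families ?S UNIV j"
    \<comment> \<open>By \<open>sums\<close>, the fibre sizes determine both the cardinality and the
      sum of \<open>v\<close> over \<open>U\<close>, so membership of \<nu> in
      \<open>families\<close> already enforces the conditions in \<open>?Z\<close>.\<close>
    then have "{U\<in>?Z. ?n U = \<nu>} = {U. U \<subseteq> ?I \<and> ?n U = \<nu>}"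
      using sums by (auto simp: families_def)
    moreover have "card {k\<in>?I. v ! k = \<beta>} = m" if "\<beta> \<in> ?S" for \<beta>
      using mult[OF that] by (simp add: count_list_eq_length_filter length_filter_conv_card eq_commute)
    moreover have "\<nu> \<in> extensional ?S" "(!) v ` ?I \<subseteq> ?S"
      using \<nu> by (auto simp: families_def PiE_def)
    ultimately show "card {U\<in>?Z. ?n U = \<nu>} = (\<Prod>\<beta>\<in>?S. m choose \<nu> \<beta>)"
      using card_subsets_with_fibre_cards[of ?I ?S "(!) v" \<nu>] by simp
  qed
  finally show ?thesis
    by (simp add: weight_distribution_code)
qed

lemma count_list_distinct: "distinct xs \<Longrightarrow> count_list xs x = (if x \<in> set xs then 1 else 0)"
  by (induction xs) auto

text \<open>Multiplicity one: the product of the \<open>1 choose \<nu> \<beta>\<close> is the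
  indicator that all entries of \<nu> lie in \<open>{0, 1}\<close>.\<close>

lemma weight_distribution_code_distinct:
  assumes "distinct xs"
  shows "weight_distribution (code xs) j = card (families (set xs) {0, 1} j)"
proof -
  have choose1: "1 choose k = (if k \<in> {0, 1} then 1 else 0 :: nat)" for k
    by (auto simp: binomial_eq_0)
  have "weight_distribution (code xs) j
      = (\<Sum>\<nu>\<in>families (set xs) UNIV j. \<Prod>\<beta>\<in>set xs. 1 choose \<nu> \<beta>)"
    using assms by (intro weight_distribution_code_constant_multiplicity) (simp add: count_list_distinct)
  also have "\<dots> = (\<Sum>\<nu>\<in>families (set xs) UNIV j. if \<nu> \<in> families (set xs) {0, 1} j then 1 else 0)"
  proof (intro sum.cong refl)
    fix \<nu> assume "\<nu> \<in> families (set xs) UNIV j"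
    then have "\<nu> \<in> families (set xs) {0, 1} j \<longleftrightarrow> (\<forall>\<beta>\<in>set xs. \<nu> \<beta> \<in> {0, 1})"
      by (auto simp: families_def PiE_iff)
    then show "(\<Prod>\<beta>\<in>set xs. 1 choose \<nu> \<beta>) = (if \<nu> \<in> families (set xs) {0, 1} j then 1 else 0)"
      unfolding choose1 by (auto intro: prod.neutral)
  qed
  also have "\<dots> = card (families (set xs) {0, 1} j)"
  proof -
    have "families (set xs) UNIV j \<inter> families (set xs) {0, 1} j = families (set xs) {0, 1} j"
      by (auto simp: families_def)
    then show ?thesis
      by (simp add: sum.If_cases finite_families)
  qed
  finally show ?thesis .
qed

lemma weight_distribution_code_append_self:
  assumes "distinct xs"
  shows "weight_distribution (code (xs @ xs)) j
    = (\<Sum>\<nu>\<in>families (set xs) UNIV j. \<Prod>\<beta>\<in>set xs. 2 choose \<nu> \<beta>)"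
proof -
  have "count_list (xs @ xs) \<beta> = 2" if "\<beta> \<in> set (xs @ xs)" for \<beta>
    using assms that by (simp add: count_list_distinct)
  from weight_distribution_code_constant_multiplicity[OF this] show ?thesis
    by simp
qed

subsection \<open>The canonical character and Kloosterman sums\<close>

locale trace_field =
  fixes r :: nat and b :: "'a::{finite, field}"
  assumes card_field: "CARD('a) = 2 ^ r"
    and tr_b: "tr r b = 1"
begin

abbreviation \<psi> :: "'a \<Rightarrow> complex" where "\<psi> \<equiv> canonical_char r"

lemma two_eq_0: "(2 :: 'a) = 0"
  using of_nat_card_eq_0[where 'a = 'a] by (simp add: card_field)

lemma frobenius_add: "(x + y :: 'a) ^ (2 ^ i) = x ^ (2 ^ i) + y ^ (2 ^ i)"
proof (induction i)
  case (Suc i)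
  have "(x + y) ^ (2 ^ Suc i) = (x ^ (2 ^ i) + y ^ (2 ^ i)) ^ 2"
    by (simp add: mult.commute flip: Suc.IH power_mult)
  also have "\<dots> = x ^ (2 ^ Suc i) + y ^ (2 ^ Suc i)"
    by (simp add: power2_sum two_eq_0 mult.commute flip: power_mult)
  finally show ?case .
qed simp

lemma tr_0 [simp]: "tr r (0 :: 'a) = 0"
  by (simp add: tr_def power_0_left)

lemma tr_add: "tr r (x + y :: 'a) = tr r x + tr r y"
  by (simp add: tr_def frobenius_add sum.distrib)

lemma tr_diff: "tr r (x - y :: 'a) = tr r x - tr r y"
  using tr_add[of "x - y" y] by (simp add: algebra_simps)

text \<open>Squaring is additive and permutes the summands of the trace cyclically, because the
  \<open>q\<close>-th power of \<open>x\<close> is \<open>x\<close>. Thus the trace is a root of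
  \<open>y * y = y\<close>.\<close>

lemma tr_cases: "tr r (x :: 'a) = 0 \<or> tr r x = 1"
proof -
  have sq: "(\<Sum>i<n. y i :: 'a) ^ 2 = (\<Sum>i<n. y i ^ 2)" for y :: "nat \<Rightarrow> 'a" and n
    by (induction n) (simp_all add: power2_sum two_eq_0)
  have "tr r x ^ 2 = (\<Sum>i<r. x ^ (2 ^ Suc i))"
    by (simp add: tr_def sq mult.commute flip: power_mult)
  also have "\<dots> = (\<Sum>i<Suc r. x ^ (2 ^ i)) - x"
    by (subst sum.lessThan_Suc_shift) simp
  also have "\<dots> = tr r x + x ^ CARD('a) - x"
    by (simp add: tr_def card_field)
  also have "\<dots> = tr r x"
    by (simp add: power_card_eq_self)
  finally show ?thesis
    by (simp add: power2_eq_square)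
qed

lemma psi_0 [simp]: "\<psi> 0 = 1"
  by (simp add: canonical_char_def)

lemma psi_add: "\<psi> (x + y) = \<psi> x * \<psi> y"
  using tr_cases[of x] tr_cases[of y] by (auto simp: canonical_char_def tr_add two_eq_0)

lemma psi_sum: "\<psi> (\<Sum>k\<in>A. f k) = (\<Prod>k\<in>A. \<psi> (f k))"
  by (induction A rule: infinite_finite_induct) (auto simp: psi_add)

text \<open>Translation by \<open>b\<close> permutes the field but multiplies each summand by
  \<open>\<psi> b = -1\<close>, so the sum equals its own negative.\<close>

lemma sum_psi: "(\<Sum>x\<in>UNIV. \<psi> x) = 0"
proof -
  have "(\<Sum>x\<in>UNIV. \<psi> x) = (\<Sum>x\<in>UNIV. \<psi> (x + b))"
    by (rule sum.reindex_bij_witness[of _ "\<lambda>x. x + b" "\<lambda>x. x - b"]) auto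
  also have "\<dots> = - (\<Sum>x\<in>UNIV. \<psi> x)"
    by (simp add: psi_add canonical_char_def[of r b] tr_b sum_negf)
  finally show ?thesis
    by simp
qed

lemma sum_psi_mult: "(\<Sum>a\<in>UNIV. \<psi> (a * c)) = (if c = 0 then of_nat (2 ^ r) else 0)"
proof (cases "c = 0")
  case False
  then have "(\<Sum>a\<in>UNIV. \<psi> (a * c)) = (\<Sum>x\<in>UNIV. \<psi> x)"
    by (intro sum.reindex_bij_witness[of _ "\<lambda>x. x / c" "\<lambda>a. a * c"]) auto
  then show ?thesis
    using False by (simp add: sum_psi)
qed (simp add: card_field)

lemma sum_psi_mult_nonzero:
  assumes "a \<noteq> 0"
  shows "(\<Sum>x\<in>UNIV - {0}. \<psi> (a * x)) = -1"
  using sum_psi_mult[of a] assms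
  by (simp add: sum_diff1 mult.commute)

text \<open>Inverting the summation variable isolates the factor \<open>\<psi> (inverse x)\<close>,
  a sign that depends only on the trace of \<open>inverse x\<close>.\<close>

lemma kloosterman_swap: "kloosterman \<psi> a = (\<Sum>x\<in>UNIV - {0}. \<psi> (a * x) * \<psi> (inverse x))"
  unfolding kloosterman_def psi_add[symmetric]
  by (rule sum.reindex_bij_witness[of _ inverse inverse]) (auto simp: add.commute)

text \<open>On nonzero \<open>x\<close>, \<open>1 + \<psi> (inverse x)\<close> and
  \<open>1 - \<psi> (inverse x)\<close> are twice the indicators of the two trace classes. The
  constant 1 contributes the character sum over nonzero elements, which is
  \<open>-1\<close>.\<close>

lemma sum_psi_inv_trace_set:
  assumes "a \<noteq> 0"
  shows "2 * (\<Sum>x\<in>inv_trace_set r 0. \<psi> (a * x)) = kloosterman \<psi> a - 1"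
    and "2 * (\<Sum>x\<in>inv_trace_set r 1. \<psi> (a * x)) = - kloosterman \<psi> a - 1"
proof -
  have "(\<Sum>x\<in>inv_trace_set r c. f x) = (\<Sum>x\<in>UNIV - {0}. if tr r (inverse x) = c then f x else 0)"
    for c and f :: "'a \<Rightarrow> complex"
    by (rule sum.mono_neutral_cong_left) (auto simp: inv_trace_set_def)
  note * = this
  have "2 * (\<Sum>x\<in>inv_trace_set r 0. \<psi> (a * x)) = (\<Sum>x\<in>UNIV - {0}. \<psi> (a * x) * \<psi> (inverse x) + \<psi> (a * x))"
    unfolding * sum_distrib_left by (intro sum.cong) (auto simp: canonical_char_def)
  then show "2 * (\<Sum>x\<in>inv_trace_set r 0. \<psi> (a * x)) = kloosterman \<psi> a - 1"
    using assms by (simp add: sum.distrib kloosterman_swap sum_psi_mult_nonzero)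
  have "2 * (\<Sum>x\<in>inv_trace_set r 1. \<psi> (a * x)) = (\<Sum>x\<in>UNIV - {0}. \<psi> (a * x) - \<psi> (a * x) * \<psi> (inverse x))"
    unfolding * sum_distrib_left
  proof (intro sum.cong refl)
    fix x :: 'a
    show "2 * (if tr r (inverse x) = 1 then \<psi> (a * x) else 0) = \<psi> (a * x) - \<psi> (a * x) * \<psi> (inverse x)"
      using tr_cases[of "inverse x"] by (auto simp: canonical_char_def[of r "inverse x"])
  qed
  then show "2 * (\<Sum>x\<in>inv_trace_set r 1. \<psi> (a * x)) = - kloosterman \<psi> a - 1"
    using assms by (simp add: sum_subtractf kloosterman_swap sum_psi_mult_nonzero)
qed

subsection \<open>Power moments\<close>

definition trace_weight :: "'a list \<Rightarrow> 'a \<Rightarrow> nat" where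
  "trace_weight v a = card {k. k < length v \<and> tr r (a * v ! k) \<noteq> 0}"

lemma trace_weight_0 [simp]: "trace_weight v 0 = 0"
  by (simp add: trace_weight_def)

text \<open>Every position contributes 1, lowered by 2 exactly where the trace is nonzero.\<close>

lemma sum_list_psi: "(\<Sum>x\<leftarrow>v. \<psi> (a * x)) = of_nat (length v) - 2 * of_nat (trace_weight v a)"
proof -
  have "(\<Sum>x\<leftarrow>v. \<psi> (a * x)) = (\<Sum>k<length v. \<psi> (a * v ! k))"
    by (simp add: sum_list_sum_nth atLeast0LessThan)
  also have "\<dots> = (\<Sum>k<length v. 1 - 2 * of_bool (tr r (a * v ! k) \<noteq> 0))"
    by (intro sum.cong) (auto simp: canonical_char_def)
  also have "\<dots> = of_nat (length v) - 2 * (\<Sum>k<length v. of_bool (tr r (a * v ! k) \<noteq> 0))"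
    by (simp only: sum_subtractf sum_distrib_left) simp
  also have "(\<Sum>k<length v. of_bool (tr r (a * v ! k) \<noteq> 0) :: complex)
      = of_nat (card ({..<length v} \<inter> {k. tr r (a * v ! k) \<noteq> 0}))"
    by (rule sum_of_bool_eq) auto
  also have "{..<length v} \<inter> {k. tr r (a * v ! k) \<noteq> 0} = {k. k < length v \<and> tr r (a * v ! k) \<noteq> 0}"
    by auto
  finally show ?thesis
    by (simp add: trace_weight_def)
qed

lemma trace_weight_choose:
  "(of_nat (trace_weight v a choose t) :: complex)
    = (\<Sum>T | T \<subseteq> {..<length v} \<and> card T = t. \<Sum>U\<in>Pow T. (-1) ^ card U * \<psi> (a * (\<Sum>k\<in>U. v ! k))) / 2 ^ t"
proof -
  let ?I = "{..<length v}" and ?W = "{k. k < length v \<and> tr r (a * v ! k) \<noteq> 0}"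
  \<comment> \<open>Each factor \<open>(1 - \<psi> (a * v ! k)) / 2\<close> is 1 if the trace is
    nonzero and 0 otherwise, so the product over \<open>T\<close> detects
    \<open>T \<subseteq> ?W\<close>. The left side is its expansion over the subsets
    \<open>U\<close> of \<open>T\<close>.\<close>
  have ind: "(\<Sum>U\<in>Pow T. (-1) ^ card U * \<psi> (a * (\<Sum>k\<in>U. v ! k))) / 2 ^ t = of_bool (T \<subseteq> ?W)"
    if T: "T \<subseteq> ?I" "card T = t" for T
  proof -
    have fin: "finite T"
      using T finite_subset by blast
    have "(\<Sum>U\<in>Pow T. (-1) ^ card U * \<psi> (a * (\<Sum>k\<in>U. v ! k))) / 2 ^ t
        = (\<Prod>k\<in>T. 1 - \<psi> (a * v ! k)) / (\<Prod>k\<in>T. 2)"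
      using T by (simp add: prod_diff_conv_sum fin psi_sum sum_distrib_left)
    also have "\<dots> = (\<Prod>k\<in>T. of_bool (tr r (a * v ! k) \<noteq> 0))"
      unfolding prod_dividef[symmetric] by (intro prod.cong) (auto simp: canonical_char_def)
    also have "\<dots> = of_bool (T \<subseteq> ?W)"
    proof (cases "T \<subseteq> ?W")
      case True
      then have "(\<Prod>k\<in>T. of_bool (tr r (a * v ! k) \<noteq> 0)) = (1 :: complex)"
        by (intro prod.neutral) auto
      then show ?thesis
        using True by simp
    next
      case False
      then have "\<exists>k\<in>T. tr r (a * v ! k) = 0"
        using T by auto
      then have "(\<Prod>k\<in>T. of_bool (tr r (a * v ! k) \<noteq> 0)) = (0 :: complex)"
        using fin by (auto intro: prod_zero)
      then show ?thesis
        using False by simp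
    qed
    finally show ?thesis .
  qed
  have finT: "finite {T. T \<subseteq> ?I \<and> card T = t}"
    by (rule finite_subset[of _ "Pow ?I"]) auto
  have "trace_weight v a choose t = card {T. T \<subseteq> ?W \<and> card T = t}"
    by (simp add: trace_weight_def n_subsets)
  also have "{T. T \<subseteq> ?W \<and> card T = t} = {T. T \<subseteq> ?I \<and> card T = t} \<inter> {T. T \<subseteq> ?W}"
    by auto
  finally have "of_nat (trace_weight v a choose t)
      = (\<Sum>T | T \<subseteq> ?I \<and> card T = t. of_bool (T \<subseteq> ?W) :: complex)"
    by (simp add: sum_of_bool_eq[OF finT])
  also have "\<dots> = (\<Sum>T | T \<subseteq> ?I \<and> card T = t. (\<Sum>U\<in>Pow T. (-1) ^ card U * \<psi> (a * (\<Sum>k\<in>U. v ! k))) / 2 ^ t)"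
    by (intro sum.cong) (auto simp: ind)
  finally show ?thesis
    by (simp add: sum_divide_distrib)
qed

lemma sum_trace_weight_choose:
  defines "N v \<equiv> int (length v)"
  shows "(\<Sum>a\<in>UNIV. of_nat (trace_weight v a choose t) :: complex)
    = 2 ^ r / 2 ^ t * (\<Sum>j\<le>length v. (-1) ^ j * of_nat (weight_distribution (code v) j)
        * of_nat (binom (N v - int j) (N v - int t)))"
proof -
  let ?I = "{..<length v}"
  let ?T = "{T. T \<subseteq> ?I \<and> card T = t}"
  let ?Z = "{U. U \<subseteq> ?I \<and> (\<Sum>k\<in>U. v ! k) = 0}"
  let ?B = "\<lambda>j. of_nat (binom (N v - int j) (N v - int t)) :: complex"
  have fin: "finite ?T" "finite ?Z"
    by (rule finite_subset[of _ "Pow ?I"]; auto)+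
  have finT: "finite T" if "T \<in> ?T" for T
    using that finite_subset by blast
  have "(\<Sum>a\<in>UNIV. of_nat (trace_weight v a choose t) :: complex)
      = (\<Sum>T\<in>?T. \<Sum>U\<in>Pow T. (-1) ^ card U * (\<Sum>a\<in>UNIV. \<psi> (a * (\<Sum>k\<in>U. v ! k)))) / 2 ^ t"
    unfolding trace_weight_choose sum_divide_distrib[symmetric] sum_distrib_left
    by (subst sum.swap[of _ ?T UNIV]) (simp only: sum.swap[of _ "Pow _" UNIV])
  \<comment> \<open>Orthogonality: the sum over \<open>a\<close> is \<open>2 ^ r\<close> for
    zero-sum \<open>U\<close>, the supports of code words, and 0 otherwise.\<close>
  also have "(\<Sum>T\<in>?T. \<Sum>U\<in>Pow T. (-1) ^ card U * (\<Sum>a\<in>UNIV. \<psi> (a * (\<Sum>k\<in>U. v ! k))))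
      = (\<Sum>T\<in>?T. \<Sum>U | U \<in> ?Z \<and> U \<subseteq> T. (-1) ^ card U * 2 ^ r)"
  proof (rule sum.cong[OF refl])
    fix T assume T: "T \<in> ?T"
    show "(\<Sum>U\<in>Pow T. (-1) ^ card U * (\<Sum>a\<in>UNIV. \<psi> (a * (\<Sum>k\<in>U. v ! k))))
        = (\<Sum>U | U \<in> ?Z \<and> U \<subseteq> T. (-1) ^ card U * 2 ^ r)"
      unfolding sum_psi_mult using T finT[OF T]
      by (intro sum.mono_neutral_cong_right) auto
  qed
  \<comment> \<open>With \<open>U\<close> outermost the summand is constant in \<open>T\<close>,
    leaving only the number of \<open>T\<close> between \<open>U\<close> and
    \<open>?I\<close>.\<close>
  also have "\<dots> = (\<Sum>U\<in>?Z. \<Sum>T | T \<in> ?T \<and> U \<subseteq> T. (-1) ^ card U * 2 ^ r)"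
    by (rule sum.swap_restrict[OF fin])
  also have "\<dots> = 2 ^ r * (\<Sum>U\<in>?Z. (-1) ^ card U * ?B (card U))"
    unfolding sum_distrib_left
  proof (rule sum.cong[OF refl])
    fix U assume "U \<in> ?Z"
    moreover have "{T. T \<in> ?T \<and> U \<subseteq> T} = {T. U \<subseteq> T \<and> T \<subseteq> ?I \<and> card T = t}"
      by auto
    ultimately have "card {T. T \<in> ?T \<and> U \<subseteq> T} = binom (N v - int (card U)) (N v - int t)"
      using card_between_subsets[of ?I U t] by (simp add: N_def)
    then show "(\<Sum>T | T \<in> ?T \<and> U \<subseteq> T. (-1) ^ card U * 2 ^ r) = 2 ^ r * ((-1) ^ card U * ?B (card U))"
      by simp
  qed
  also have "(\<Sum>U\<in>?Z. (-1) ^ card U * ?B (card U))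
      = (\<Sum>j\<le>length v. \<Sum>U | U \<in> ?Z \<and> card U = j. (-1) ^ card U * ?B (card U))"
    by (rule sum.group[symmetric]) (use fin card_mono[of ?I] in auto)
  also have "\<dots> = (\<Sum>j\<le>length v. (-1) ^ j * of_nat (weight_distribution (code v) j) * ?B j)"
  proof (rule sum.cong[OF refl])
    fix j
    have "{U. U \<in> ?Z \<and> card U = j} = {U. U \<subseteq> ?I \<and> card U = j \<and> (\<Sum>k\<in>U. v ! k) = 0}"
      by auto
    then have "card {U. U \<in> ?Z \<and> card U = j} = weight_distribution (code v) j"
      by (simp only: weight_distribution_code)
    moreover have "(\<Sum>U | U \<in> ?Z \<and> card U = j. (-1) ^ card U * ?B (card U))
        = of_nat (card {U. U \<in> ?Z \<and> card U = j}) * ((-1) ^ j * ?B j)"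
      by simp
    ultimately show "(\<Sum>U | U \<in> ?Z \<and> card U = j. (-1) ^ card U * ?B (card U))
        = (-1) ^ j * of_nat (weight_distribution (code v) j) * ?B j"
      by simp
  qed
  finally show ?thesis
    by simp
qed

lemma pless_power_moment:
  defines "N v \<equiv> int (length v)"
  shows "(\<Sum>a\<in>UNIV. of_nat (trace_weight v a) ^ h :: complex)
    = 2 ^ r * (\<Sum>j=0..min (length v) h. (-1) ^ j * of_nat (weight_distribution (code v) j)
        * (\<Sum>t=j..h. fact t * of_nat (Stirling h t) / 2 ^ t * of_nat (binom (N v - int j) (N v - int t))))"
proof -
  let ?C = "\<lambda>j. of_nat (weight_distribution (code v) j) :: complex"
  let ?B = "\<lambda>j t. of_nat (binom (N v - int j) (N v - int t)) :: complex"
  let ?S = "\<lambda>t. fact t * of_nat (Stirling h t) / 2 ^ t :: complex"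
  have "(\<Sum>a\<in>UNIV. of_nat (trace_weight v a) ^ h :: complex)
      = (\<Sum>a\<in>UNIV. \<Sum>t\<le>h. fact t * of_nat (Stirling h t) * of_nat (trace_weight v a choose t))"
    unfolding of_nat_power[symmetric] power_eq_sum_Stirling by simp
  also have "\<dots> = (\<Sum>t\<le>h. fact t * of_nat (Stirling h t) * (\<Sum>a\<in>UNIV. of_nat (trace_weight v a choose t)))"
    by (subst sum.swap) (simp add: sum_distrib_left)
  also have "\<dots> = (\<Sum>t\<le>h. \<Sum>j\<le>length v. 2 ^ r * ((-1) ^ j * ?C j * (?S t * ?B j t)))"
    unfolding sum_trace_weight_choose N_def by (simp add: sum_distrib_left mult_ac)
  also have "\<dots> = 2 ^ r * (\<Sum>j\<le>length v. (-1) ^ j * ?C j * (\<Sum>t\<le>h. ?S t * ?B j t))"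
    by (subst sum.swap) (simp add: sum_distrib_left)
  \<comment> \<open>For \<open>t < j\<close> the lower index of \<open>binom\<close> exceeds the
    upper one. Once those terms are dropped, the inner sum is empty for \<open>j > h\<close>, which
    gives the cut-off at \<open>min (length v) h\<close>.\<close>
  also have "(\<Sum>j\<le>length v. (-1) ^ j * ?C j * (\<Sum>t\<le>h. ?S t * ?B j t))
      = (\<Sum>j\<le>length v. (-1) ^ j * ?C j * (\<Sum>t=j..h. ?S t * ?B j t))"
  proof -
    have "(\<Sum>t\<le>h. ?S t * ?B j t) = (\<Sum>t=j..h. ?S t * ?B j t)" for j
      by (rule sum.mono_neutral_right) (auto simp: binom_def)
    then show ?thesis
      by (simp only:)
  qed
  also have "\<dots> = (\<Sum>j=0..min (length v) h. (-1) ^ j * ?C j * (\<Sum>t=j..h. ?S t * ?B j t))"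
    by (rule sum.mono_neutral_right) auto
  finally show ?thesis .
qed

text \<open>One statement covers all four codes: \<open>s\<close> is the sign of the Kloosterman sum
  in the weight, and \<open>m\<close> is 1 for doubled vectors and 2 for single ones. Expanding the
  \<open>h\<close>-th power of \<open>c + s * kloosterman \<psi> a\<close> and solving for the term
  \<open>l = h\<close> gives the recursion.\<close>

lemma MK_recursion:
  fixes s c :: complex
  assumes s: "s * s = 1" and "h \<ge> 1" and m: "m \<ge> 1"
    and weight: "\<And>a. a \<noteq> 0 \<Longrightarrow> 2 ^ m * of_nat (trace_weight v a) = c + s * kloosterman \<psi> a"
  defines "N \<equiv> int (length v)"
  shows "MK \<psi> h = - (\<Sum>l=0..h-1. s ^ (h + l) * of_nat (h choose l) * c ^ (h - l) * MK \<psi> l)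
    + 2 ^ r * (\<Sum>j=0..min (length v) h. s ^ h * (-1) ^ j * of_nat (weight_distribution (code v) j)
        * (\<Sum>t=j..h. fact t * of_nat (Stirling h t) * 2 ^ (m * h - t)
             * of_nat (binom (N - int j) (N - int t))))"
    (is "_ = - ?L + 2 ^ r * ?R")
proof -
  let ?C = "\<lambda>j. of_nat (weight_distribution (code v) j) :: complex"
  let ?B = "\<lambda>j t. of_nat (binom (N - int j) (N - int t)) :: complex"
  \<comment> \<open>\<open>s ^ h\<close> is its own inverse, so multiplying by it isolates
    \<open>MK \<psi> h\<close> and turns \<open>s ^ l\<close> into
    \<open>s ^ (h + l)\<close>.\<close>
  have ss: "s ^ h * s ^ h = 1"
    using s by (simp flip: power_mult_distrib)
  have "(\<Sum>a\<in>UNIV - {0}. (2 ^ m * of_nat (trace_weight v a)) ^ h)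
      = (\<Sum>a\<in>UNIV - {0}. (s * kloosterman \<psi> a + c) ^ h)"
    by (intro sum.cong refl) (simp add: weight add.commute)
  also have "\<dots> = (\<Sum>l\<le>h. of_nat (h choose l) * s ^ l * c ^ (h - l) * MK \<psi> l)"
    unfolding binomial_ring MK_def
    by (subst sum.swap) (simp add: sum_distrib_left power_mult_distrib mult_ac)
  also have "\<dots> = s ^ h * MK \<psi> h + (\<Sum>l=0..h-1. of_nat (h choose l) * s ^ l * c ^ (h - l) * MK \<psi> l)"
    using \<open>h \<ge> 1\<close> by (cases h) (simp_all add: atLeast0AtMost)
  finally have A: "(\<Sum>a\<in>UNIV - {0}. (2 ^ m * of_nat (trace_weight v a)) ^ h) = \<dots>" .
  have "s ^ h * (\<Sum>a\<in>UNIV - {0}. (2 ^ m * of_nat (trace_weight v a)) ^ h) = MK \<psi> h + ?L"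
    unfolding A distrib_left mult.assoc[symmetric] ss sum_distrib_left
    by (simp add: power_add mult_ac)
  moreover have "s ^ h * (\<Sum>a\<in>UNIV - {0}. (2 ^ m * of_nat (trace_weight v a)) ^ h) = 2 ^ r * ?R"
  proof -
    \<comment> \<open>From \<open>m \<ge> 1\<close> comes \<open>t \<le> m * h\<close>, so the
      truncated subtraction in the exponent is exact.\<close>
    have pow: "2 ^ (m * h) * (x / 2 ^ t) = x * 2 ^ (m * h - t)" if "t \<le> h" for t and x :: complex
    proof -
      have "t \<le> m * h"
        using that m by (metis mult_le_mono1 mult_1 le_trans)
      then show ?thesis
        by (simp add: power_diff)
    qed
    \<comment> \<open>The point \<open>a = 0\<close> can be added because its weight is 0 and
      \<open>h \<ge> 1\<close>.\<close>
    have "(\<Sum>a\<in>UNIV - {0}. (2 ^ m * of_nat (trace_weight v a)) ^ h)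
        = (\<Sum>a\<in>UNIV. (2 ^ m * of_nat (trace_weight v a) :: complex) ^ h)"
      using \<open>h \<ge> 1\<close> by (intro sum.mono_neutral_left) auto
    also have "\<dots> = 2 ^ (m * h) * (\<Sum>a\<in>UNIV. of_nat (trace_weight v a) ^ h)"
      by (simp add: power_mult_distrib sum_distrib_left power_mult)
    also have "\<dots> = 2 ^ r * (\<Sum>j=0..min (length v) h. (-1) ^ j * ?C j
        * (\<Sum>t=j..h. 2 ^ (m * h) * (fact t * of_nat (Stirling h t) / 2 ^ t) * ?B j t))"
      unfolding pless_power_moment N_def by (simp add: sum_distrib_left mult_ac)
    also have "\<dots> = 2 ^ r * (\<Sum>j=0..min (length v) h. (-1) ^ j * ?C j
        * (\<Sum>t=j..h. fact t * of_nat (Stirling h t) * 2 ^ (m * h - t) * ?B j t))"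
    proof -
      have "(\<Sum>t=j..h. 2 ^ (m * h) * (fact t * of_nat (Stirling h t) / 2 ^ t) * ?B j t)
          = (\<Sum>t=j..h. fact t * of_nat (Stirling h t) * 2 ^ (m * h - t) * ?B j t)" for j
        by (rule sum.cong[OF refl]) (simp only: atLeastAtMost_iff pow)
      then show ?thesis
        by (simp only:)
    qed
    finally show ?thesis
      by (simp add: sum_distrib_left mult_ac)
  qed
  ultimately show ?thesis
    by (simp add: algebra_simps)
qed

section \<open>Weights and enumerations for the four defining vectors\<close>

text \<open>Comparing \<open>sum_list_psi\<close> with \<open>sum_psi_inv_trace_set\<close>
  eliminates the character sum; doubling the list doubles that sum. The powers of 2 and the factor
  \<open>-1\<close> are written out to match \<open>m\<close> and \<open>s\<close> in
  \<open>MK_recursion\<close>.\<close>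

lemma trace_weight_enumeration_0:
  assumes "distinct xs" "set xs = inv_trace_set r 0" "a \<noteq> 0"
  shows "2 ^ 1 * of_nat (trace_weight (xs @ xs) a) = (2 * of_nat (length xs) + 1) + (-1) * kloosterman \<psi> a"
    and "2 ^ 2 * of_nat (trace_weight xs a) = (2 * of_nat (length xs) + 1) + (-1) * kloosterman \<psi> a"
proof -
  let ?S = "\<Sum>x\<in>inv_trace_set r 0. \<psi> (a * x)"
  note S = sum_psi_inv_trace_set(1)[OF assms(3)]
  have "?S + ?S = 2 * of_nat (length xs) - 2 * of_nat (trace_weight (xs @ xs) a)"
    using sum_list_psi[of a "xs @ xs"] assms(1,2) by (simp add: sum_list_distinct_conv_sum_set)
  then show "2 ^ 1 * of_nat (trace_weight (xs @ xs) a) = (2 * of_nat (length xs) + 1) + (-1) * kloosterman \<psi> a"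
    using S by algebra
  have "?S = of_nat (length xs) - 2 * of_nat (trace_weight xs a)"
    using sum_list_psi[of a xs] assms(1,2) by (simp add: sum_list_distinct_conv_sum_set)
  then show "2 ^ 2 * of_nat (trace_weight xs a) = (2 * of_nat (length xs) + 1) + (-1) * kloosterman \<psi> a"
    using S by algebra
qed

lemma trace_weight_enumeration_1:
  assumes "distinct xs" "set xs = inv_trace_set r 1" "a \<noteq> 0"
  shows "2 ^ 1 * of_nat (trace_weight (xs @ xs) a) = (2 * of_nat (length xs) + 1) + 1 * kloosterman \<psi> a"
    and "2 ^ 2 * of_nat (trace_weight xs a) = (2 * of_nat (length xs) + 1) + 1 * kloosterman \<psi> a"
proof -
  let ?S = "\<Sum>x\<in>inv_trace_set r 1. \<psi> (a * x)"
  note S = sum_psi_inv_trace_set(2)[OF assms(3)]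
  have "?S + ?S = 2 * of_nat (length xs) - 2 * of_nat (trace_weight (xs @ xs) a)"
    using sum_list_psi[of a "xs @ xs"] assms(1,2) by (simp add: sum_list_distinct_conv_sum_set)
  then show "2 ^ 1 * of_nat (trace_weight (xs @ xs) a) = (2 * of_nat (length xs) + 1) + 1 * kloosterman \<psi> a"
    using S by algebra
  have "?S = of_nat (length xs) - 2 * of_nat (trace_weight xs a)"
    using sum_list_psi[of a xs] assms(1,2) by (simp add: sum_list_distinct_conv_sum_set)
  then show "2 ^ 2 * of_nat (trace_weight xs a) = (2 * of_nat (length xs) + 1) + 1 * kloosterman \<psi> a"
    using S by algebra
qed

lemma vec2_enumerates:
  assumes enum: "bij_betw \<gamma> {..<n div 2} {\<beta> :: 'a. tr r \<beta> = 0}" and "\<gamma> 0 = 0" "n \<ge> 2"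
  shows "distinct (vec2 n \<gamma>)" and "set (vec2 n \<gamma>) = inv_trace_set r 0"
proof -
  have 0: "0 < n div 2"
    using \<open>n \<ge> 2\<close> by simp
  have inj: "inj_on \<gamma> {..<n div 2}" and im: "\<gamma> ` {..<n div 2} = {\<beta>. tr r \<beta> = 0}"
    using enum by (auto simp: bij_betw_def)
  show "distinct (vec2 n \<gamma>)"
    using inj by (auto simp: vec2_def distinct_map inj_on_def)
  \<comment> \<open>By injectivity, omitting index 0 removes exactly the element 0 from the
    trace-zero set, so only nonzero elements get inverted.\<close>
  have "\<gamma> ` {1..<n div 2} = \<gamma> ` ({..<n div 2} - {0})"
    by (intro arg_cong[of _ _ "(`) \<gamma>"]) auto
  also have "\<dots> = {\<beta>. tr r \<beta> = 0} - {0}"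
    using inj_on_image_set_diff[OF inj, of "{..<n div 2}" "{0}"] 0 im \<open>\<gamma> 0 = 0\<close> by simp
  finally have "set (vec2 n \<gamma>) = inverse ` ({\<beta>. tr r \<beta> = 0} - {0})"
    by (simp add: vec2_def flip: image_image)
  also have "\<dots> = inv_trace_set r 0"
    by (auto simp: inv_trace_set_def intro!: image_eqI[of _ inverse "inverse _"])
  finally show "set (vec2 n \<gamma>) = inv_trace_set r 0" .
qed

text \<open>Translation by \<open>b\<close> carries the kernel of the trace onto its trace-one
  coset. This coset avoids 0, so index 0 can stay.\<close>

lemma vec4_enumerates:
  assumes enum: "bij_betw \<gamma> {..<n div 2} {\<beta> :: 'a. tr r \<beta> = 0}"
  shows "distinct (vec4 n b \<gamma>)" and "set (vec4 n b \<gamma>) = inv_trace_set r 1"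
proof -
  have inj: "inj_on \<gamma> {..<n div 2}" and im: "\<gamma> ` {..<n div 2} = {\<beta>. tr r \<beta> = 0}"
    using enum by (auto simp: bij_betw_def)
  show "distinct (vec4 n b \<gamma>)"
    using inj by (auto simp: vec4_def distinct_map inj_on_def)
  have "set (vec4 n b \<gamma>) = (\<lambda>\<beta>. inverse (b + \<beta>)) ` \<gamma> ` {..<n div 2}"
    by (simp add: vec4_def image_image atLeast0LessThan)
  also have "\<dots> = inv_trace_set r 1"
    unfolding im
  proof (intro equalityI subsetI)
    fix x assume "x \<in> (\<lambda>\<beta>. inverse (b + \<beta>)) ` {\<beta>. tr r \<beta> = 0}"
    then obtain \<beta> where \<beta>: "x = inverse (b + \<beta>)" "tr r \<beta> = 0"
      by auto
    then have "tr r (b + \<beta>) = 1"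
      by (simp add: tr_add tr_b)
    moreover from this have "b + \<beta> \<noteq> 0"
      by (metis tr_0 zero_neq_one)
    ultimately show "x \<in> inv_trace_set r 1"
      by (simp add: inv_trace_set_def \<beta>)
  next
    fix x :: 'a assume "x \<in> inv_trace_set r 1"
    then have "tr r (inverse x - b) = 0"
      by (simp add: inv_trace_set_def tr_diff tr_b)
    then show "x \<in> (\<lambda>\<beta>. inverse (b + \<beta>)) ` {\<beta>. tr r \<beta> = 0}"
      by (intro image_eqI[of _ _ "inverse x - b"]) auto
  qed
  finally show "set (vec4 n b \<gamma>) = inv_trace_set r 1" .
qed

end

section \<open>The four recursions and weight distributions\<close>

theorem theorem1:
  fixes r q :: nat
    and b :: "'a::{finite, field}"
    and \<gamma> :: "nat \<Rightarrow> 'a"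
    and \<psi> :: "'a \<Rightarrow> complex"
  assumes r: "r \<ge> 1"
    and q: "q = 2 ^ r"
    and card_field: "CARD('a) = q"
    and psi: "\<psi> = canonical_char r"
    and b: "tr r b = 1"
    and enum: "bij_betw \<gamma> {..<q div 2} {\<beta>. tr r \<beta> = 0}"
    and enum0: "\<gamma> 0 = 0"
  shows
    "(r \<ge> 3 \<longrightarrow>
         (\<forall>h\<ge>1. MK \<psi> h =
            (\<Sum>l=0..h-1. (-1) ^ (h + l + 1) * of_nat (h choose l) * (of_nat q - 1) ^ (h - l) * MK \<psi> l)
            + of_nat q * (\<Sum>j=0..min (q - 2) h. (-1) ^ (h + j)
                * of_nat (weight_distribution (code (vec1 q \<gamma>)) j)
                * (\<Sum>t=j..h. fact t * of_nat (Stirling h t) * 2 ^ (h - t)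
                     * of_nat (binom (int q - 2 - int j) (int q - 2 - int t)))))
         \<and> (\<forall>j\<le>q - 2. weight_distribution (code (vec1 q \<gamma>)) j =
            (\<Sum>\<nu>\<in>families (inv_trace_set r (0::'a)) UNIV j.
               \<Prod>\<beta>\<in>inv_trace_set r 0. 2 choose \<nu> \<beta>)))
     \<and> (r \<ge> 3 \<longrightarrow>
         (\<forall>h\<ge>1. MK \<psi> h =
            (\<Sum>l=0..h-1. (-1) ^ (h + l + 1) * of_nat (h choose l) * (of_nat q - 1) ^ (h - l) * MK \<psi> l)
            + of_nat q * (\<Sum>j=0..min (q div 2 - 1) h. (-1) ^ (h + j)
                * of_nat (weight_distribution (code (vec2 q \<gamma>)) j)
                * (\<Sum>t=j..h. fact t * of_nat (Stirling h t) * 2 ^ (2 * h - t)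
                     * of_nat (binom (int (q div 2) - 1 - int j) (int (q div 2) - 1 - int t)))))
         \<and> (\<forall>j\<le>q div 2 - 1. weight_distribution (code (vec2 q \<gamma>)) j =
            card (families (inv_trace_set r (0::'a)) {0, 1} j)))
     \<and> ((\<forall>h\<ge>1. MK \<psi> h =
            - (\<Sum>l=0..h-1. of_nat (h choose l) * (of_nat q + 1) ^ (h - l) * MK \<psi> l)
            + of_nat q * (\<Sum>j=0..min q h. (-1) ^ j
                * of_nat (weight_distribution (code (vec3 q b \<gamma>)) j)
                * (\<Sum>t=j..h. fact t * of_nat (Stirling h t) * 2 ^ (h - t)
                     * of_nat (binom (int q - int j) (int q - int t)))))
         \<and> (\<forall>j\<le>q. weight_distribution (code (vec3 q b \<gamma>)) j =
            (\<Sum>\<nu>\<in>families (inv_trace_set r (1::'a)) UNIV j.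
               \<Prod>\<beta>\<in>inv_trace_set r 1. 2 choose \<nu> \<beta>)))
     \<and> ((\<forall>h\<ge>1. MK \<psi> h =
            - (\<Sum>l=0..h-1. of_nat (h choose l) * (of_nat q + 1) ^ (h - l) * MK \<psi> l)
            + of_nat q * (\<Sum>j=0..min (q div 2) h. (-1) ^ j
                * of_nat (weight_distribution (code (vec4 q b \<gamma>)) j)
                * (\<Sum>t=j..h. fact t * of_nat (Stirling h t) * 2 ^ (2 * h - t)
                     * of_nat (binom (int (q div 2) - int j) (int (q div 2) - int t)))))
         \<and> (\<forall>j\<le>q div 2. weight_distribution (code (vec4 q b \<gamma>)) j =
            card (families (inv_trace_set r (1::'a)) {0, 1} j)))"
proof -
  interpret trace_field r b
    using card_field q b by unfold_locales auto
  have q_even: "even q" and q_ge: "q \<ge> 2"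
    using q r by (auto simp: self_le_power)
  have of_nat_q: "of_nat q = (2 :: complex) ^ r"
    by (simp add: q)
  have vec1: "vec1 q \<gamma> = vec2 q \<gamma> @ vec2 q \<gamma>" and vec3: "vec3 q b \<gamma> = vec4 q b \<gamma> @ vec4 q b \<gamma>"
    by (simp_all add: vec1_def vec2_def vec3_def vec4_def)
  have length: "length (vec1 q \<gamma>) = q - 2" "length (vec2 q \<gamma>) = q div 2 - 1"
    "length (vec3 q b \<gamma>) = q" "length (vec4 q b \<gamma>) = q div 2"
    using q_even by (auto simp: vec1_def vec2_def vec3_def vec4_def elim!: evenE)
  have int_length: "int (q - 2) = int q - 2" "int (q div 2 - 1) = int (q div 2) - 1"
    using q_ge by auto
  \<comment> \<open>This is the constant \<open>c\<close> of \<open>MK_recursion\<close>: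
    \<open>q - 1\<close> for trace class 0, and by \<open>length_4\<close> it is
    \<open>q + 1\<close> for trace class 1.\<close>
  have length_2: "2 * of_nat (length (vec2 q \<gamma>)) + 1 = (of_nat q - 1 :: complex)"
    unfolding length(2) using q_even q_ge by (auto simp: of_nat_diff elim!: evenE)
  have length_4: "2 * of_nat (length (vec4 q b \<gamma>)) + 1 = (of_nat q + 1 :: complex)"
    unfolding length(4) using q_even by (auto elim!: evenE)
  note enum_2 = vec2_enumerates[OF enum enum0 q_ge]
  note enum_4 = vec4_enumerates[OF enum]
  note weight_0 = trace_weight_enumeration_0[OF enum_2, unfolded length_2]
  note weight_1 = trace_weight_enumeration_1[OF enum_4, unfolded length_4]
  have "MK \<psi> h =
      (\<Sum>l=0..h-1. (-1) ^ (h + l + 1) * of_nat (h choose l) * (of_nat q - 1) ^ (h - l) * MK \<psi> l)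
      + of_nat q * (\<Sum>j=0..min (q - 2) h. (-1) ^ (h + j)
          * of_nat (weight_distribution (code (vec1 q \<gamma>)) j)
          * (\<Sum>t=j..h. fact t * of_nat (Stirling h t) * 2 ^ (h - t)
               * of_nat (binom (int q - 2 - int j) (int q - 2 - int t))))" if "h \<ge> 1" for h
    \<comment> \<open>Here \<open>s = -1\<close>: the leading minus sign is absorbed into
      \<open>(-1) ^ (h + l + 1)\<close>, and \<open>s ^ h * (-1) ^ j\<close> becomes
      \<open>(-1) ^ (h + j)\<close>.\<close>
    using MK_recursion[OF _ that order.refl weight_0(1), folded vec1, unfolded length(1) int_length]
    by (simp add: psi power_add of_nat_q sum_negf)
  moreover have "MK \<psi> h =
      (\<Sum>l=0..h-1. (-1) ^ (h + l + 1) * of_nat (h choose l) * (of_nat q - 1) ^ (h - l) * MK \<psi> l)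
      + of_nat q * (\<Sum>j=0..min (q div 2 - 1) h. (-1) ^ (h + j)
          * of_nat (weight_distribution (code (vec2 q \<gamma>)) j)
          * (\<Sum>t=j..h. fact t * of_nat (Stirling h t) * 2 ^ (2 * h - t)
               * of_nat (binom (int (q div 2) - 1 - int j) (int (q div 2) - 1 - int t))))" if "h \<ge> 1" for h
    using MK_recursion[OF _ that one_le_numeral weight_0(2), unfolded length(2) int_length]
    by (simp add: psi power_add of_nat_q sum_negf)
  moreover have "MK \<psi> h =
      - (\<Sum>l=0..h-1. of_nat (h choose l) * (of_nat q + 1) ^ (h - l) * MK \<psi> l)
      + of_nat q * (\<Sum>j=0..min q h. (-1) ^ j
          * of_nat (weight_distribution (code (vec3 q b \<gamma>)) j)
          * (\<Sum>t=j..h. fact t * of_nat (Stirling h t) * 2 ^ (h - t)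
               * of_nat (binom (int q - int j) (int q - int t))))" if "h \<ge> 1" for h
    using MK_recursion[OF _ that order.refl weight_1(1), folded vec3, unfolded length(3)]
    by (simp add: psi of_nat_q)
  moreover have "MK \<psi> h =
      - (\<Sum>l=0..h-1. of_nat (h choose l) * (of_nat q + 1) ^ (h - l) * MK \<psi> l)
      + of_nat q * (\<Sum>j=0..min (q div 2) h. (-1) ^ j
          * of_nat (weight_distribution (code (vec4 q b \<gamma>)) j)
          * (\<Sum>t=j..h. fact t * of_nat (Stirling h t) * 2 ^ (2 * h - t)
               * of_nat (binom (int (q div 2) - int j) (int (q div 2) - int t))))" if "h \<ge> 1" for h
    using MK_recursion[OF _ that one_le_numeral weight_1(2), unfolded length(4)]
    by (simp add: psi of_nat_q)
  moreover note weight_distribution_code_append_self[OF enum_2(1), folded vec1, unfolded enum_2(2)]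
    weight_distribution_code_distinct[OF enum_2(1), unfolded enum_2(2)]
    weight_distribution_code_append_self[OF enum_4(1), folded vec3, unfolded enum_4(2)]
    weight_distribution_code_distinct[OF enum_4(1), unfolded enum_4(2)]
  ultimately show ?thesis
    by blast
qed

end
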